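(* Let $G$ be a digraph consisting of two cycles, each of length at least $3$, that have only one common vertex. Then for each of the two cycles $C$ of $G$ there is a complete realisation of $G\subset G'$ (for a suitable $G'$ obtained from $G$ by adding edges between existing vertices) such that the only positive transverse eigenvalue of the cycle $C$ is at the distribution node, i.e. at the equilibrium corresponding to the distribution vertex of $G$.
   Context: Digraphs. All digraphs $G=(V,A)$ are finite, with at most one edge $[v_j\to v_i]$ for each ordered pair of vertices. A digraph consists of two cycles if it is the connected union of two different directed cycles and contains no other cycles. Such a digraph has exactly one vertex of out-degree greater than $1$, called the distribution vertex; if the cycles have only one common vertex, it is this vertex. Simplex method. Let $G'=(V,A')$ be a strongly connected digraph on $V=\{v_1,\dots,v_n\}$ without 1-cycles and 2-cycles. The simplex method associates with $G'$ the system on $\mathbb{R}^n$ $$\dot x_i = x_i\Big(1-|x|^2+\sum_{j=1}^n a_{ji}x_j^2\Big),\quad i=1,\dots,n,$$ with $a_{ii}=0$, and for $i\ne j$: $a_{ji}>0$ if $[v_j\to v_i]\in A'$ and $a_{ji}<0$ otherwise. The vertex $v_j$ corresponds to the equilibrium $\xi_j$, the unit vector on the positive $x_j$-axis; the eigenvalue of the linearisation at $\xi_j$ in the direction of $x_i$ ($i\neq j$) is $a_{ji}$ and the radial eigenvalue is $-2$. For each edge $[v_j\to v_i]\in A'$ there is a heteroclinic connection $[\xi_j\to\xi_i]$ (a non-empty intersection $W^u(\xi_j)\cap W^s(\xi_i)$) containing a trajectory in the $(x_j,x_i)$-coordinate plane. The system is equivariant under $\mathbb{Z}_2^n$ acting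 by reflections in the coordinate hyperplanes, and equilibria and connections are understood up to this symmetry (equivalently, one works in the closed orthant $x_i\ge 0$). The heteroclinic network $X$ realising $G'$ consists of the equilibria $\xi_j$ and the full sets of connections $W^u(\xi_j)\cap W^s(\xi_i)$. Completeness. A heteroclinic network is complete if it contains the unstable manifolds of all its equilibria, i.e. every trajectory in every $W^u(\xi_j)$ converges in forward time to one of the equilibria of the network. Complete realisation. For a strongly connected digraph $G=(V,A)$ without 1- and 2-cycles and a digraph $G'=(V,A')$ with the same vertex set, $A\subset A'$, and without 1- and 2-cycles, $G\subset G'$ has a complete realisation if the simplex method applied to $G'$ (with suitable coefficients of the prescribed signs) produces a complete heteroclinic network $X$; then $X$ is called a complete realisation of $G\subset G'$. Transverse eigenvalues. Let $C$ be a cycle of $G$, viewed as a heteroclinic cycle in $X$ using the connecting trajectories in coordinate planes. At an equilibrium $\xi_j$ of $C$, with predecessor $\xi_p$ and successor $\xi_s$ in $C$, the eigenvalue in direction $x_j$ is radial, in direction $x_p$ contracting, in direction $x_s$ expanding, and the eigenvalues $a_{ji}$ in all remaining directions $x_i$, $i\notin\{j,p,s\}$, are the transverse eigenvalues of $C$ at $\xi_j$. *)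

theory Defs
  imports "HOL-Analysis.Analysis" "Graph_Theory.Graph_Theory"
begin

section \<open>Digraphs\<close>

text \<open>
  A digraph with at most one edge per ordered pair of vertices is a \<^typ>\<open>'v pair_pre_digraph\<close>;
  the pair \<open>(j, i)\<close> is the edge from \<open>j\<close> to \<open>i\<close>.  A directed cycle is given, as in
  \<open>pre_digraph.cycle\<close>, by the list of its edges in cyclic order from an arbitrary starting vertex.
  Lists that differ by a rotation are the same cycle, so cycles are compared by their edge sets.
\<close>

definition cycle_verts :: "('v \<times> 'v) list \<Rightarrow> 'v set" where
  "cycle_verts C = fst ` set C"

definition consists_of_two_cycles ::
    "'v pair_pre_digraph \<Rightarrow> ('v \<times> 'v) list \<Rightarrow> ('v \<times> 'v) list \<Rightarrow> bool" where
  "consists_of_two_cycles G C1 C2 \<longleftrightarrow>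
     pair_fin_digraph G \<and>
     Digraph_Component.connected (with_proj G) \<and>
     pre_digraph.cycle (with_proj G) C1 \<and>
     pre_digraph.cycle (with_proj G) C2 \<and>
     set C1 \<noteq> set C2 \<and>
     pverts G = cycle_verts C1 \<union> cycle_verts C2 \<and>
     parcs G = set C1 \<union> set C2 \<and>
     (\<forall>C. pre_digraph.cycle (with_proj G) C \<longrightarrow> set C = set C1 \<or> set C = set C2)"

definition distribution_vertex :: "'v pair_pre_digraph \<Rightarrow> 'v" where
  "distribution_vertex G = (THE v. v \<in> pverts G \<and> out_degree (with_proj G) v > 1)"

definition no_1_2_cycles :: "'v pair_pre_digraph \<Rightarrow> bool" where
  "no_1_2_cycles G \<longleftrightarrow> (\<forall>C. pre_digraph.cycle (with_proj G) C \<longrightarrow> length C \<noteq> 1 \<and> length C \<noteq> 2)"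


section \<open>Autonomous differential equations\<close>

definition solves_on :: "(real \<Rightarrow> 'a::real_normed_vector) \<Rightarrow> ('a \<Rightarrow> 'a) \<Rightarrow> real set \<Rightarrow> bool" where
  "solves_on x f T \<longleftrightarrow> (\<forall>t\<in>T. (x has_vector_derivative f (x t)) (at t within T))"

text \<open>
  A solution is required to exist on the whole half-line.  In particular, if a point lies in a
  stable manifold then its forward trajectory does not blow up.
\<close>

definition unstable_manifold :: "('a::real_normed_vector \<Rightarrow> 'a) \<Rightarrow> 'a \<Rightarrow> 'a set" where
  "unstable_manifold f \<xi> = {p. \<exists>x. solves_on x f {..0} \<and> x 0 = p \<and> (x \<longlongrightarrow> \<xi>) at_bot}"

definition stable_manifold :: "('a::real_normed_vector \<Rightarrow> 'a) \<Rightarrow> 'a \<Rightarrow> 'a set" where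
  "stable_manifold f \<xi> = {p. \<exists>x. solves_on x f {0..} \<and> x 0 = p \<and> (x \<longlongrightarrow> \<xi>) at_top}"

text \<open>\<open>\<mu>\<close> is the eigenvalue of the linearisation of \<open>f\<close> at \<open>\<xi>\<close> in the direction of \<open>x\<^sub>i\<close>.\<close>

definition eigenvalue_in_direction ::
    "(real^'v \<Rightarrow> real^'v) \<Rightarrow> real^'v \<Rightarrow> 'v::finite \<Rightarrow> real \<Rightarrow> bool" where
  "eigenvalue_in_direction f \<xi> i \<mu> \<longleftrightarrow>
     (\<exists>D. (f has_derivative D) (at \<xi>) \<and> D (axis i 1) = \<mu> *\<^sub>R axis i 1)"


section \<open>The simplex method\<close>

text \<open>
  The phase space has one coordinate per vertex, so the vertex set of the digraph is the whole
  (finite) type \<open>'v\<close>.  The coefficient \<open>a j i\<close> is \<open>a\<^sub>j\<^sub>i\<close>, associated with the edge from \<open>j\<close> to \<open>i\<close>.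
\<close>

definition simplex_field :: "('v \<Rightarrow> 'v \<Rightarrow> real) \<Rightarrow> real^'v \<Rightarrow> real^'v::finite" where
  "simplex_field a x =
     (\<chi> i. x $ i * (1 - (norm x)\<^sup>2 + (\<Sum>j\<in>UNIV. a j i * (x $ j)\<^sup>2)))"

definition simplex_coefficients :: "('v::finite) pair_pre_digraph \<Rightarrow> ('v \<Rightarrow> 'v \<Rightarrow> real) \<Rightarrow> bool" where
  "simplex_coefficients G a \<longleftrightarrow>
     (\<forall>i. a i i = 0) \<and>
     (\<forall>j i. j \<noteq> i \<longrightarrow> (if (j, i) \<in> parcs G then a j i > 0 else a j i < 0))"

definition equil :: "'v \<Rightarrow> real^'v::finite" where
  "equil j = axis j 1"

text \<open>The symmetry group of reflections is factored out by working in the closed orthant.\<close>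

definition orthant :: "(real^'v::finite) set" where
  "orthant = {x. \<forall>i. 0 \<le> x $ i}"

definition connection :: "('v \<Rightarrow> 'v \<Rightarrow> real) \<Rightarrow> 'v \<Rightarrow> 'v \<Rightarrow> (real^'v::finite) set" where
  "connection a j i =
     unstable_manifold (simplex_field a) (equil j) \<inter>
     stable_manifold (simplex_field a) (equil i) \<inter> orthant"

definition simplex_network :: "('v::finite) pair_pre_digraph \<Rightarrow> ('v \<Rightarrow> 'v \<Rightarrow> real) \<Rightarrow> (real^'v) set" where
  "simplex_network G a = range equil \<union> (\<Union>(j, i)\<in>parcs G. connection a j i)"

definition plane_connection :: "('v \<Rightarrow> 'v \<Rightarrow> real) \<Rightarrow> 'v \<Rightarrow> 'v \<Rightarrow> (real \<Rightarrow> real^'v::finite) \<Rightarrow> bool" where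
  "plane_connection a j i x \<longleftrightarrow>
     solves_on x (simplex_field a) UNIV \<and>
     (x \<longlongrightarrow> equil j) at_bot \<and> (x \<longlongrightarrow> equil i) at_top \<and>
     (\<forall>t. x t \<in> orthant \<inter> span {equil j, equil i})"

definition realises :: "('v::finite) pair_pre_digraph \<Rightarrow> ('v \<Rightarrow> 'v \<Rightarrow> real) \<Rightarrow> bool" where
  "realises G a \<longleftrightarrow> (\<forall>(j, i)\<in>parcs G. \<exists>x. plane_connection a j i x)"

text \<open>
  Since the connections in \<^const>\<open>simplex_network\<close> consist of points whose forward trajectory exists
  for all time and converges to an equilibrium, the following inclusion says that every
  trajectory in an unstable manifold converges to an equilibrium of the network.
\<close>

definition complete_network :: "('v::finite) pair_pre_digraph \<Rightarrow> ('v \<Rightarrow> 'v \<Rightarrow> real) \<Rightarrow> bool" where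
  "complete_network G a \<longleftrightarrow>
     (\<forall>j. unstable_manifold (simplex_field a) (equil j) \<inter> orthant \<subseteq> simplex_network G a)"

text \<open>The complete realisation of \<open>G \<subseteq> G'\<close> is \<open>simplex_network G' a\<close>.\<close>

definition complete_realisation ::
    "('v::finite) pair_pre_digraph \<Rightarrow> 'v pair_pre_digraph \<Rightarrow> ('v \<Rightarrow> 'v \<Rightarrow> real) \<Rightarrow> bool" where
  "complete_realisation G G' a \<longleftrightarrow>
     pverts G = UNIV \<and> strongly_connected (with_proj G) \<and> no_1_2_cycles G \<and>
     spanning (with_proj G) (with_proj G') \<and> no_1_2_cycles G' \<and>
     simplex_coefficients G' a \<and> realises G' a \<and> complete_network G' a"

text \<open>
  The directions \<open>i\<close> transverse to \<open>C\<close> at \<open>j\<close> are those that are neither radial (\<open>i = j\<close>), nor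
  contracting (\<open>i\<close> precedes \<open>j\<close> in \<open>C\<close>), nor expanding (\<open>i\<close> succeeds \<open>j\<close> in \<open>C\<close>).
\<close>

definition transverse :: "('v \<times> 'v) list \<Rightarrow> 'v \<Rightarrow> 'v \<Rightarrow> bool" where
  "transverse C j i \<longleftrightarrow> j \<in> cycle_verts C \<and> i \<noteq> j \<and> (i, j) \<notin> set C \<and> (j, i) \<notin> set C"

text \<open>
  A transverse eigenvalue is identified by the pair \<open>(j, i)\<close> of the equilibrium at which
  it is taken and its direction, so that equal values at different places are not conflated.
\<close>

definition positive_transverse_eigenvalues ::
    "('v \<Rightarrow> 'v \<Rightarrow> real) \<Rightarrow> ('v \<times> 'v) list \<Rightarrow> ('v \<times> 'v::finite) set" where
  "positive_transverse_eigenvalues a C =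
     {(j, i). transverse C j i \<and>
        (\<exists>\<mu>>0. eigenvalue_in_direction (simplex_field a) (equil j) i \<mu>)}"

lemma eigenvalue_in_direction_equil:
  fixes a :: "'v::finite \<Rightarrow> 'v \<Rightarrow> real"
  assumes "i \<noteq> j"
  shows "eigenvalue_in_direction (simplex_field a) (equil j) i \<mu> \<longleftrightarrow> \<mu> = a j i"
proof -
  let ?\<xi> = "equil j :: real^'v"
  define D :: "real^'v \<Rightarrow> real^'v" where
    "D h = (\<chi> k. ?\<xi> $ k * (- (2 * (?\<xi> \<bullet> h)) + (\<Sum>l\<in>UNIV. a l k * (2 * ?\<xi> $ l * h $ l)))
              + h $ k * (1 - (norm ?\<xi>)\<^sup>2 + (\<Sum>l\<in>UNIV. a l k * (?\<xi> $ l)\<^sup>2)))" for h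
  have comp: "((\<lambda>x. x $ k * (1 - (norm x)\<^sup>2 + (\<Sum>l\<in>UNIV. a l k * (x $ l)\<^sup>2)))
      has_derivative (\<lambda>h. D h $ k)) (at ?\<xi>)" for k
    unfolding D_def power2_norm_eq_inner
    by (auto intro!: derivative_eq_intros bounded_linear_imp_has_derivative[OF bounded_linear_vec_nth]
             simp: inner_commute mult.commute mult.left_commute)
  have D: "(simplex_field a has_derivative D) (at ?\<xi>)"
    using comp by (subst has_derivative_componentwise_within)
      (auto simp: Basis_vec_def inner_axis simplex_field_def)
  have sum1: "(\<Sum>l\<in>UNIV. a l k * (?\<xi> $ l)\<^sup>2) = a j k" for k
    using sum.delta[of UNIV j "\<lambda>l. a l k"]
    by (simp add: equil_def axis_def if_distrib[of "\<lambda>y. y\<^sup>2"] if_distrib[of "\<lambda>y. _ * y"] cong: if_cong)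
  have sum2: "(\<Sum>l\<in>UNIV. a l k * (2 * ?\<xi> $ l * (axis i 1 :: real^'v) $ l)) = 0" for k
    using assms by (intro sum.neutral) (auto simp: equil_def axis_def)
  have norm1: "(norm ?\<xi>)\<^sup>2 = 1"
    by (simp add: equil_def)
  have orth: "?\<xi> \<bullet> axis i 1 = 0"
    using assms by (simp add: equil_def inner_axis_axis)
  have "D (axis i 1) = a j i *\<^sub>R axis i 1"
    unfolding D_def sum1 sum2 norm1 orth using assms
    by (auto simp: vec_eq_iff axis_def)
  moreover have "D' = D" if "(simplex_field a has_derivative D') (at ?\<xi>)" for D'
    using has_derivative_unique[OF that D] .
  moreover have "(axis i 1 :: real^'v) \<noteq> 0" by (simp add: axis_eq_0_iff)
  ultimately show ?thesis
    using D unfolding eigenvalue_in_direction_def by (metis scaleR_right_imp_eq)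
qed

end

theory Submission
  imports Defs "HOL-Real_Asymp.Real_Asymp"
begin

text \<open>
  Let \<open>d\<close> be the common vertex, \<open>C\<close> the cycle under consideration, \<open>D\<close> the other one, and \<open>u\<close>, \<open>w\<close>
  the successors of \<open>d\<close> on \<open>C\<close> and \<open>D\<close>.  The digraph \<open>G'\<close> arises from \<open>G\<close> by adding an edge to \<open>u\<close> from
  each vertex of \<open>D\<close> other than \<open>d\<close>.  No new edge starts on \<open>C\<close>, so the only edge leaving
  \<open>C\<close> is the edge from \<open>d\<close> to \<open>w\<close>, and this gives the only positive transverse eigenvalue
  (\<open>transverse_arcs_completed\<close>).  Moreover, each vertex \<open>j\<close> of \<open>G'\<close> has either one out-neighbour, or
  two out-neighbours \<open>q\<close>, \<open>r\<close> that are themselves joined by an edge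
  (\<open>out_neighbours_completed\<close>); that is, the vertex and its out-neighbours form a
  transitive tournament.

  The coefficients are \<open>1\<close> on edges and \<open>- 1\<close> on all other pairs of distinct vertices.  A
  trajectory in the unstable manifold of \<open>\<xi>\<^sub>j\<close> has vanishing coordinates except at \<open>j\<close> and its
  out-neighbours (\<open>unstable_trajectory_contracting\<close>).  On this tournament the coefficients are
  antisymmetric, so the trajectory stays on the unit sphere
  (\<open>unstable_trajectory_sphere\<close>).  There the equations can be solved in closed form: in the squares of
  the coordinates, the last vertex of the tournament and, in reversed time, the first one
  follow a logistic equation, and the middle coordinate is determined by the other two
  (\<open>orbit_solves\<close>).  The formulas show that each point of the unstable manifold is an equilibrium or
  tends to the equilibrium of an out-neighbour of \<open>j\<close>, which is completeness
  (\<open>complete_network_sign\<close>); applied to a single edge they give the connections in the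
  coordinate planes (\<open>realises_sign\<close>).
\<close>

section \<open>Walks and cycles\<close>

text \<open>
  Along a walk from \<open>u\<close> to \<open>v\<close> every vertex visited is a tail except the last and a head except
  the first.  On a closed walk the sets of tails and heads therefore coincide.
\<close>

lemma pcas_set_snd: "pcas u p v \<Longrightarrow> insert v (fst ` set p) = insert u (snd ` set p)"
  by (induction p arbitrary: u) auto

lemma pcas_rtrancl: "pcas u p v \<Longrightarrow> (u, v) \<in> (set p)\<^sup>*"
proof (induction p arbitrary: u)
  case (Cons e p)
  have "(snd e, v) \<in> (set p)\<^sup>*" and u: "fst e = u" using Cons by auto
  then have "(snd e, v) \<in> (set (e # p))\<^sup>*"
    by (meson rtrancl_mono set_subset_Cons subsetD)
  moreover have "(u, snd e) \<in> set (e # p)" using u by auto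
  ultimately show ?case by (rule converse_rtrancl_into_rtrancl[rotated])
qed auto

lemma pcas_append: "pcas u (p @ p') v \<longleftrightarrow> (\<exists>w. pcas u p w \<and> pcas w p' v)"
  by (induction p arbitrary: u) auto

context
  fixes H :: "'v pair_pre_digraph" and C :: "('v \<times> 'v) list"
  assumes cycle: "pre_digraph.cycle (with_proj H) C"
begin

lemma cycle_walk:
  obtains u where "pcas u C u" "distinct (map snd C)" "C \<noteq> []" "set C \<subseteq> parcs H"
proof -
  from cycle obtain u where u: "pre_digraph.awalk (with_proj H) u C u"
      "distinct (tl (pre_digraph.awalk_verts (with_proj H) u C))" "C \<noteq> []"
    unfolding pre_digraph.cycle_def by blast
  have "pre_digraph.cas (with_proj H) u C u" and sub: "set C \<subseteq> parcs H"
    using u(1) by (auto simp: pre_digraph.awalk_def)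
  with u have "distinct (map snd C)"
    by (simp add: pre_digraph.awalk_verts_conv')
  with \<open>pre_digraph.cas (with_proj H) u C u\<close> sub u(3) show thesis
    by (intro that[of u]) (auto simp: cas_with_proj_eq)
qed

lemma cycle_verts_eq_heads: "cycle_verts C = snd ` set C"
proof -
  obtain u where "pcas u C u" "C \<noteq> []" by (rule cycle_walk)
  moreover from this have "u \<in> fst ` set C" by (cases C) auto
  moreover have "u \<in> snd ` set C"
    using \<open>pcas u C u\<close> \<open>C \<noteq> []\<close> by (cases C rule: rev_cases) (auto simp: pcas_append)
  ultimately show ?thesis
    using pcas_set_snd[of u C u] by (auto simp: cycle_verts_def insert_absorb)
qed

lemma card_cycle_verts: "card (cycle_verts C) = length C"
proof -
  obtain u where "distinct (map snd C)" by (rule cycle_walk)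
  then show ?thesis unfolding cycle_verts_eq_heads
    by (metis distinct_card length_map set_map)
qed

lemma cycle_arc_verts:
  assumes "(x, y) \<in> set C" shows "x \<in> cycle_verts C" "y \<in> cycle_verts C"
  using assms cycle_verts_eq_heads by (force simp: cycle_verts_def)+

lemma cycle_unique_successor:
  assumes "(x, y) \<in> set C" "(x, z) \<in> set C" shows "y = z"
proof -
  have "card (set (map fst C)) = length (map fst C)"
    using card_cycle_verts by (simp add: cycle_verts_def)
  then have "distinct (map fst C)" by (rule card_distinct)
  then show ?thesis using assms by (rule eq_key_imp_eq_value)
qed

lemma cycle_has_successor:
  assumes "x \<in> cycle_verts C" obtains y where "(x, y) \<in> set C"
  using assms by (force simp: cycle_verts_def)

lemma cycle_connected:
  assumes "x \<in> cycle_verts C" "y \<in> cycle_verts C" shows "(x, y) \<in> (set C)\<^sup>*"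
proof -
  obtain u where u: "pcas u C u" by (rule cycle_walk)
  have split: "(u, x) \<in> (set C)\<^sup>* \<and> (x, u) \<in> (set C)\<^sup>*" if "x \<in> cycle_verts C" for x
  proof -
    obtain e where e: "e \<in> set C" "fst e = x" using \<open>x \<in> cycle_verts C\<close>
      by (auto simp: cycle_verts_def)
    then obtain p p' where C: "C = p @ e # p'" by (meson split_list)
    then have "pcas u p x" "pcas x (e # p') u" using u e by (auto simp: pcas_append)
    then have "(u, x) \<in> (set p)\<^sup>*" "(x, u) \<in> (set (e # p'))\<^sup>*"
      by (blast intro: pcas_rtrancl)+
    moreover have "(set p)\<^sup>* \<subseteq> (set C)\<^sup>*" "(set (e # p'))\<^sup>* \<subseteq> (set C)\<^sup>*"
      by (auto intro!: rtrancl_mono simp: C)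
    ultimately show ?thesis by blast
  qed
  show ?thesis using split[OF assms(1)] split[OF assms(2)] by auto
qed

text \<open>
  If both \<open>(x, y)\<close> and \<open>(y, x)\<close> lay on the cycle, then \<open>{x, y}\<close> would be closed under taking
  successors, hence would be the whole cycle.
\<close>

lemma cycle_asym:
  assumes "length C \<ge> 3" "(x, y) \<in> set C" shows "(y, x) \<notin> set C"
proof
  assume yx: "(y, x) \<in> set C"
  have "z \<in> {x, y}" if "(x, z) \<in> (set C)\<^sup>*" for z
    using that by induction (use cycle_unique_successor assms(2) yx in blast)+
  then have "cycle_verts C \<subseteq> {x, y}"
    using cycle_connected cycle_arc_verts(1)[OF assms(2)] by blast
  then have "card (cycle_verts C) \<le> card {x, y}" by (intro card_mono) auto
  also have "\<dots> \<le> 2" by (simp add: card_insert_if)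
  finally show False using card_cycle_verts assms(1) by simp
qed

end

lemma asym_imp_no_1_2_cycles:
  assumes "asym (parcs H)" shows "no_1_2_cycles H"
  unfolding no_1_2_cycles_def
proof (intro allI impI)
  fix C assume C: "pre_digraph.cycle (with_proj H) C"
  obtain u where u: "pcas u C u" "set C \<subseteq> parcs H" using C by (rule cycle_walk)
  show "length C \<noteq> 1 \<and> length C \<noteq> 2"
  proof (intro conjI notI)
    assume "length C = 1"
    then obtain e where "C = [e]" by (auto simp: length_Suc_conv)
    with u have "(u, u) \<in> parcs H" by (cases e) auto
    then show False using assms by (meson asymD)
  next
    assume "length C = 2"
    then obtain e e' where "C = [e, e']" by (auto simp: length_Suc_conv numeral_2_eq_2)
    with u have "(u, snd e) \<in> parcs H" "(snd e, u) \<in> parcs H"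
      by (cases e; cases e'; auto)+
    then show False using assms by (meson asymD)
  qed
qed

section \<open>Two cycles with one common vertex\<close>

text \<open>
  Two cycles of length at least three glued at the vertex \<open>d\<close>.  The cycles are kept apart by their
  role: \<open>C\<close> is the one whose transverse eigenvalues are to be controlled and \<open>D\<close> is the one
  whose vertices receive additional outgoing edges.  The vertices \<open>u\<close> and \<open>w\<close> are the successors of
  \<open>d\<close> on \<open>C\<close> and on \<open>D\<close>.
\<close>

locale two_cycles_at_vertex =
  fixes G :: "('v::finite) pair_pre_digraph" and C D :: "('v \<times> 'v) list" and d u w :: 'v
  assumes verts: "pverts G = UNIV"
    and arcs: "parcs G = set C \<union> set D"
    and C: "pre_digraph.cycle (with_proj G) C" "length C \<ge> 3"
    and D: "pre_digraph.cycle (with_proj G) D" "length D \<ge> 3"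
    and cover: "cycle_verts C \<union> cycle_verts D = UNIV"
    and common: "cycle_verts C \<inter> cycle_verts D = {d}"
    and du: "(d, u) \<in> set C" and dw: "(d, w) \<in> set D"
begin

lemmas C_succ = cycle_unique_successor[OF C(1)] and D_succ = cycle_unique_successor[OF D(1)]
lemmas C_verts = cycle_arc_verts[OF C(1)] and D_verts = cycle_arc_verts[OF D(1)]
lemmas C_asym = cycle_asym[OF C] and D_asym = cycle_asym[OF D]

lemma in_both: "x \<in> cycle_verts C \<Longrightarrow> x \<in> cycle_verts D \<Longrightarrow> x = d"
  using common by blast

lemma u_notin_D: "u \<notin> cycle_verts D"
  using in_both C_verts(2)[OF du] C_asym[OF du] du by metis

lemma w_notin_C: "w \<notin> cycle_verts C"
  using in_both D_verts(2)[OF dw] D_asym[OF dw] dw by metis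

lemma d_in: "d \<in> cycle_verts C" "d \<in> cycle_verts D"
  using common by blast+

lemma strongly_connected: "strongly_connected (with_proj G)"
proof -
  have wf: "wf_digraph (with_proj G)" by unfold_locales (auto simp: verts)
  have "(x, y) \<in> (parcs G)\<^sup>*" for x y
  proof -
    have "(z, d) \<in> (parcs G)\<^sup>* \<and> (d, z) \<in> (parcs G)\<^sup>*" for z
    proof -
      have "(set C)\<^sup>* \<subseteq> (parcs G)\<^sup>*" "(set D)\<^sup>* \<subseteq> (parcs G)\<^sup>*"
        by (auto intro!: rtrancl_mono simp: arcs)
      moreover have "z \<in> cycle_verts C \<or> z \<in> cycle_verts D" using cover by blast
      ultimately show ?thesis
        using cycle_connected[OF C(1)] cycle_connected[OF D(1)] d_in by blast
    qed
    then show ?thesis by (meson rtrancl_trans)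
  qed
  moreover have "x \<rightarrow>\<^sup>*\<^bsub>with_proj G\<^esub> y" if "(x, y) \<in> (parcs G)\<^sup>*" for x y
    using that
  proof induction
    case base show ?case by (simp add: wf_digraph.reachable_refl[OF wf] verts)
  next
    case (step y z) then show ?case by (auto intro: wf_digraph.reachable_adj_trans[OF wf])
  qed
  ultimately show ?thesis by (auto simp: strongly_connected_def verts)
qed

lemma distribution_vertex: "distribution_vertex G = d"
  unfolding distribution_vertex_def
proof (rule the_equality)
  have "{(d, u), (d, w)} \<subseteq> out_arcs (with_proj G) d" using du dw by (auto simp: arcs)
  moreover have "finite (out_arcs (with_proj G) d)" by (rule finite)
  ultimately have "card {(d, u), (d, w)} \<le> card (out_arcs (with_proj G) d)"
    by (intro card_mono)
  moreover have "u \<noteq> w" using u_notin_D D_verts(2)[OF dw] by blast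
  ultimately show "d \<in> pverts G \<and> 1 < out_degree (with_proj G) d"
    by (simp add: out_degree_def verts)
next
  fix v assume v: "v \<in> pverts G \<and> 1 < out_degree (with_proj G) v"
  show "v = d"
  proof (rule ccontr)
    assume "v \<noteq> d"
    have uniq: "e = e'" if "e \<in> out_arcs (with_proj G) v" "e' \<in> out_arcs (with_proj G) v" for e e'
      using that \<open>v \<noteq> d\<close> in_both C_succ D_succ C_verts(1) D_verts(1)
      by (cases e; cases e'; simp add: arcs) blast
    then have "card (out_arcs (with_proj G) v) \<le> 1"
      using finite[of "out_arcs (with_proj G) v"]
      by (simp only: One_nat_def card_le_Suc0_iff_eq)  blast
    then show False using v by (simp add: out_degree_def)
  qed
qed

text \<open>
  Since \<open>d\<close> has the two out-neighbours \<open>u\<close> and \<open>w\<close>, its unstable manifold is two-dimensional.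
  Without an edge between \<open>u\<close> and \<open>w\<close>, both of these equilibria would attract an open set of its
  trajectories, and a trajectory separating the two sets would tend to neither.  The edge must leave \<open>w\<close>, since an edge leaving \<open>u\<close> would give \<open>C\<close> a further positive transverse eigenvalue.
  Now \<open>w\<close> has two out-neighbours, \<open>u\<close> and its successor on \<open>D\<close>, and the same reasoning asks for an
  edge from that successor to \<open>u\<close>, and so on along \<open>D\<close>.  The process stops because \<open>D\<close> returns to
  \<open>d\<close>, which already has an edge to \<open>u\<close>.
\<close>

definition completed :: "'v pair_pre_digraph" where
  "completed = \<lparr>pverts = UNIV, parcs = parcs G \<union> (cycle_verts D - {d}) \<times> {u}\<rparr>"

lemma completed_arcs:
  "(x, y) \<in> parcs completed \<longleftrightarrow>
     (x, y) \<in> set C \<or> (x, y) \<in> set D \<or> (x \<in> cycle_verts D \<and> x \<noteq> d \<and> y = u)"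
  by (auto simp: completed_def arcs)

lemma spanning_completed: "spanning (with_proj G) (with_proj completed)"
proof -
  have "wf_digraph (with_proj G)" "wf_digraph (with_proj completed)"
    by (unfold_locales; simp add: verts completed_def)+
  then show ?thesis by (auto simp: spanning_def subgraph_def verts completed_def)
qed

text \<open>
  The vertex \<open>u\<close> lies on \<open>C\<close> only, so its single outgoing edge is the one of \<open>C\<close>.  That edge does not
  end at \<open>d\<close>, the only vertex that \<open>C\<close> shares with \<open>D\<close>, because \<open>C\<close> is not a 2-cycle.  Hence no
  new edge has its reverse in the digraph.
\<close>

lemma asym_completed: "asym (parcs completed)"
proof (rule asymI)
  fix x y assume "(x, y) \<in> parcs completed"
  then show "(y, x) \<notin> parcs completed"
    using C_asym D_asym C_verts D_verts in_both u_notin_D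
    unfolding completed_arcs by metis
qed

lemma no_1_2_cycles_G: "no_1_2_cycles G"
  using asym_completed by (intro asym_imp_no_1_2_cycles) (auto simp: asym_on_def completed_def)

text \<open>
  The combinatorial property that makes the network complete: each out-neighbourhood is a single
  vertex or the two ends of an edge, so a vertex together with its out-neighbours spans a
  transitive tournament.
\<close>

lemma out_neighbours_completed:
  "\<exists>q r. {i. (j, i) \<in> parcs completed} = {q, r} \<and> (q = r \<or> (q, r) \<in> parcs completed)"
proof -
  consider "j = d" | "j \<in> cycle_verts C" "j \<noteq> d" | "j \<in> cycle_verts D" "j \<noteq> d"
    using cover by blast
  then show ?thesis
  proof cases
    case 1
    have "{i. (j, i) \<in> parcs completed} = {w, u}"
      unfolding completed_arcs using 1 du dw C_succ D_succ by blast
    moreover have "(w, u) \<in> parcs completed"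
      unfolding completed_arcs using w_notin_C D_verts(2)[OF dw] d_in by blast
    ultimately show ?thesis by blast
  next
    case 2
    obtain s where s: "(j, s) \<in> set C" using cycle_has_successor[OF C(1) 2(1)] by blast
    have "{i. (j, i) \<in> parcs completed} = {s, s}"
      unfolding completed_arcs using 2 s C_succ D_verts(1) in_both by blast
    then show ?thesis by blast
  next
    case 3
    obtain s where s: "(j, s) \<in> set D" using cycle_has_successor[OF D(1) 3(1)] by blast
    have "{i. (j, i) \<in> parcs completed} = {s, u}"
      unfolding completed_arcs using 3 s D_succ C_verts(1) in_both by blast
    moreover have "(s, u) \<in> parcs completed"
      unfolding completed_arcs using D_verts(2)[OF s] du by blast
    ultimately show ?thesis by blast
  qed
qed

text \<open>
  All new edges start outside \<open>C\<close>, so at the vertices of \<open>C\<close> only the edges of \<open>G\<close> matter, and the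
  cycles share no vertex but \<open>d\<close>.
\<close>

lemma transverse_arcs_completed:
  "{(j, i). transverse C j i \<and> (j, i) \<in> parcs completed} = {(d, w)}"
proof (intro equalityI subsetI)
  fix e assume "e \<in> {(j, i). transverse C j i \<and> (j, i) \<in> parcs completed}"
  then obtain j i where e: "e = (j, i)" "transverse C j i" "(j, i) \<in> parcs completed" by blast
  then have "(j, i) \<in> set D" "j = d"
    using in_both D_verts(1) unfolding completed_arcs transverse_def by blast+
  then show "e \<in> {(d, w)}" using D_succ[OF dw] e(1) by blast
next
  fix e assume "e \<in> {(d, w)}"
  moreover have "transverse C d w"
    using d_in w_notin_C C_verts unfolding transverse_def by blast
  ultimately show "e \<in> {(j, i). transverse C j i \<and> (j, i) \<in> parcs completed}"
    using dw by (simp add: completed_arcs)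
qed

end

section \<open>Unstable manifolds\<close>

text \<open>
  The simplex method gives Kolmogorov systems, in which each coordinate satisfies a linear equation
  whose coefficient is the growth rate below.
\<close>

definition growth :: "('v \<Rightarrow> 'v \<Rightarrow> real) \<Rightarrow> 'v \<Rightarrow> real^'v::finite \<Rightarrow> real" where
  "growth a i x = 1 - (norm x)\<^sup>2 + (\<Sum>j\<in>UNIV. a j i * (x $ j)\<^sup>2)"

lemma simplex_field_component: "simplex_field a x $ i = growth a i x * x $ i"
  by (simp add: simplex_field_def growth_def)

lemma solves_component:
  assumes "solves_on x (simplex_field a) T" "t \<in> T"
  shows "((\<lambda>s. x s $ i) has_real_derivative growth a i (x t) * x t $ i) (at t within T)"
proof -
  have "(x has_vector_derivative simplex_field a (x t)) (at t within T)"
    using assms by (simp add: solves_on_def)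
  then have "((\<lambda>s. x s $ i) has_vector_derivative simplex_field a (x t) $ i) (at t within T)"
    by (rule bounded_linear.has_vector_derivative[OF bounded_linear_vec_nth])
  then show ?thesis
    by (simp add: has_real_derivative_iff_has_vector_derivative simplex_field_component)
qed

lemma norm_sq_components: "(norm x)\<^sup>2 = (\<Sum>i\<in>UNIV. (x $ i)\<^sup>2)" for x :: "real^'v::finite"
  unfolding power2_norm_eq_inner inner_vec_def by (simp add: power2_eq_square)

lemma growth_equil: "growth a i (equil j) = a j i"
proof -
  have "(\<Sum>l\<in>UNIV. a l i * (equil j $ l)\<^sup>2) = (\<Sum>l\<in>UNIV. if l = j then a l i else 0)"
    by (intro sum.cong) (auto simp: equil_def axis_def)
  then show ?thesis by (simp add: growth_def equil_def)
qed

lemma continuous_growth: "continuous_on UNIV (growth a i)"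
  unfolding growth_def by (intro continuous_intros)

lemma tendsto_growth:
  assumes "(x \<longlongrightarrow> equil j) F" shows "((\<lambda>t. growth a i (x t)) \<longlongrightarrow> a j i) F"
  using continuous_on_tendsto_compose[OF continuous_growth[of a i] assms] by (simp add: growth_equil)

text \<open>
  A mean value argument that needs derivatives relative to \<open>S\<close> only: trajectories in unstable
  manifolds live on the half-line of nonpositive times and have one-sided derivatives at \<open>0\<close>.
\<close>

lemma nonincreasing_within:
  fixes z :: "real \<Rightarrow> real"
  assumes "s \<le> t" "\<And>\<tau>. s \<le> \<tau> \<Longrightarrow> \<tau> \<le> t \<Longrightarrow> (z has_real_derivative z' \<tau>) (at \<tau> within S)"
    and "{s..t} \<subseteq> S" "\<And>\<tau>. s \<le> \<tau> \<Longrightarrow> \<tau> \<le> t \<Longrightarrow> z' \<tau> \<le> 0"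
  shows "z t \<le> z s"
proof (cases "s = t")
  case False
  then have "s < t" using assms(1) by simp
  moreover have "(z has_derivative (\<lambda>h. h * z' \<tau>)) (at \<tau> within {s..t})"
      if "s \<le> \<tau>" "\<tau> \<le> t" for \<tau>
    using DERIV_subset[OF assms(2)[OF that] assms(3)]
    by (simp add: has_field_derivative_def mult_commute_abs)
  ultimately obtain \<tau> where "\<tau> \<in> {s<..<t}" "z t - z s = (t - s) * z' \<tau>"
    using mvt_simple[of s t z "\<lambda>\<tau> h. h * z' \<tau>"] by auto
  moreover from this have "(t - s) * z' \<tau> \<le> 0"
    using assms(4)[of \<tau>] by (intro mult_nonneg_nonpos) auto
  ultimately show ?thesis by linarith
qed simp

lemma zero_if_decaying_backwards:
  fixes z :: "real \<Rightarrow> real"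
  assumes "(z \<longlongrightarrow> 0) at_bot" "z T \<ge> 0"
    and "\<And>t. t \<le> T \<Longrightarrow> (z has_real_derivative z' t) (at t within S)"
    and "{..T} \<subseteq> S" "\<And>t. t \<le> T \<Longrightarrow> z' t \<le> 0"
  shows "z T = 0"
proof -
  have "z T \<le> z s" if "s \<le> T" for s
    using assms that by (intro nonincreasing_within[of s T z z' S]) auto
  then have "eventually (\<lambda>s. z T \<le> z s) at_bot"
    by (meson eventually_at_bot_linorder)
  then have "z T \<le> 0"
    using assms(1) by (intro tendsto_lowerbound[of z 0 at_bot]) auto
  then show ?thesis using assms(2) by simp
qed

text \<open>
  If \<open>M\<close> bounds \<open>g\<close> from above, then \<open>y\<^sup>2 exp (- 2 M t)\<close> is nonincreasing.
\<close>

lemma linear_ode_stays_zero: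
  fixes y g :: "real \<Rightarrow> real"
  assumes y: "\<And>t. t \<in> {s..b} \<Longrightarrow> (y has_real_derivative g t * y t) (at t within S)"
    and S: "{s..b} \<subseteq> S" and g: "continuous_on {s..b} g" and "y s = 0" "s \<le> b"
  shows "y b = 0"
proof -
  have "bounded (g ` {s..b})"
    using g by (intro compact_imp_bounded compact_continuous_image) auto
  then obtain M where M: "\<And>t. t \<in> {s..b} \<Longrightarrow> g t \<le> M"
    unfolding bounded_iff by (force simp: abs_le_iff)
  define w where "w t = (y t)\<^sup>2 * exp (- (2 * M * t))" for t
  have "w b \<le> w s"
  proof (rule nonincreasing_within[where z = w and S = S
        and z' = "\<lambda>t. 2 * (g t - M) * (y t)\<^sup>2 * exp (- (2 * M * t))"])
    fix t assume t: "s \<le> t" "t \<le> b"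
    show "(w has_real_derivative (2 * (g t - M) * (y t)\<^sup>2 * exp (- (2 * M * t)))) (at t within S)"
      unfolding w_def using t
      by (auto intro!: derivative_eq_intros y simp: power2_eq_square algebra_simps)
    show "2 * (g t - M) * (y t)\<^sup>2 * exp (- (2 * M * t)) \<le> 0"
      using M[of t] t by (simp add: mult_nonpos_nonneg)
  qed (use assms in auto)
  then show ?thesis using \<open>y s = 0\<close> by (simp add: w_def mult_le_0_iff)
qed

context
  fixes a :: "'v::finite \<Rightarrow> 'v \<Rightarrow> real" and x :: "real \<Rightarrow> real^'v" and j :: 'v
  assumes sol: "solves_on x (simplex_field a) {..0}" and lim: "(x \<longlongrightarrow> equil j) at_bot"
begin

text \<open>
  Near the equilibrium a coordinate with negative eigenvalue decreases in modulus as time goes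
  forward, yet it tends to \<open>0\<close> in backward time; so it vanishes for early times, and then for
  all times because the coordinate hyperplane is invariant.
\<close>

lemma unstable_trajectory_contracting:
  assumes "a j i < 0" "i \<noteq> j" "t \<le> 0"
  shows "x t $ i = 0"
proof -
  have "eventually (\<lambda>t. growth a i (x t) < 0) at_bot"
    using tendsto_growth[OF lim, of a i] assms(1) by (rule order_tendstoD)
  then obtain T0 where T0: "\<And>t. t \<le> T0 \<Longrightarrow> growth a i (x t) < 0"
    unfolding eventually_at_bot_linorder by blast
  have lim_i: "((\<lambda>t. (x t $ i)\<^sup>2) \<longlongrightarrow> 0) at_bot"
    using tendsto_power[OF tendsto_vec_nth[OF lim, of i], of 2] assms(2)
    by (simp add: equil_def axis_def)
  have deriv: "((\<lambda>t. (x t $ i)\<^sup>2) has_real_derivative 2 * growth a i (x t) * (x t $ i)\<^sup>2)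
      (at t within {..0})" if "t \<le> 0" for t
    using that by (auto intro!: derivative_eq_intros solves_component[OF sol] simp: power2_eq_square)
  \<comment> \<open>a time early enough for the sign of the growth rate to be settled\<close>
  define s where "s = min T0 t"
  have s: "s \<le> T0" "s \<le> t" "s \<le> 0" using assms(3) by (auto simp: s_def)
  have "(x s $ i)\<^sup>2 = 0"
  proof (rule zero_if_decaying_backwards[OF lim_i _ deriv])
    show "2 * growth a i (x t) * (x t $ i)\<^sup>2 \<le> 0" if "t \<le> s" for t
      using T0[of t] that s by (simp add: mult_nonpos_nonneg)
  qed (use s in auto)
  then have "x s $ i = 0" by simp
  moreover have "continuous_on {..0} x"
    using sol unfolding solves_on_def continuous_on_eq_continuous_within
    by (blast intro: has_vector_derivative_continuous)
  then have "continuous_on {s..t} (\<lambda>\<tau>. growth a i (x \<tau>))"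
    using assms(3)
    by (intro continuous_on_compose2[OF continuous_growth]) (auto intro: continuous_on_subset)
  ultimately show ?thesis
    using assms(3) s
    by (intro linear_ode_stays_zero[of s t "\<lambda>t. x t $ i" "\<lambda>t. growth a i (x t)" "{..0}"]
        solves_component[OF sol]) auto
qed

text \<open>
  Only the directions in which the eigenvalue at the equilibrium is nonnegative are excited.  If the
  coefficients are antisymmetric there, the interaction terms cancel in the equation for the
  square \<open>S\<close> of the norm, which becomes \<open>S' = 2 S (1 - S)\<close>.  Hence \<open>(S - 1)\<^sup>2\<close> is nonincreasing, and it
  tends to \<open>0\<close> in backward time.
\<close>

lemma unstable_trajectory_sphere:
  assumes antisym: "\<And>i k. i \<noteq> j \<longrightarrow> a j i \<ge> 0 \<Longrightarrow> k \<noteq> j \<longrightarrow> a j k \<ge> 0 \<Longrightarrow> a i k = - a k i"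
    and "t \<le> 0"
  shows "norm (x t) = 1"
proof -
  define S where "S t = (norm (x t))\<^sup>2" for t
  have radial: "(S has_real_derivative 2 * S t * (1 - S t)) (at t within {..0})" if "t \<le> 0" for t
  proof -
    let ?X = "\<lambda>i. (x t $ i)\<^sup>2"
    \<comment> \<open>the total interaction, equal to its own negative by antisymmetry\<close>
    define I where "I = (\<Sum>i\<in>UNIV. \<Sum>k\<in>UNIV. a k i * (?X k * ?X i))"
    have "x t $ l = 0 \<or> (l \<noteq> j \<longrightarrow> a j l \<ge> 0)" for l
      using unstable_trajectory_contracting[of l t] that by fastforce
    then have cases: "x t $ k = 0 \<or> x t $ i = 0 \<or> a k i = - a i k" for i k
      using antisym[of k i] by blast
    have anti: "a k i * (?X k * ?X i) = - (a i k * (?X i * ?X k))" for i k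
      using cases[of k i] by (elim disjE) (simp_all only: mult.commute, simp_all)
    have "I = - (\<Sum>i\<in>UNIV. \<Sum>k\<in>UNIV. a i k * (?X i * ?X k))"
      unfolding I_def sum_negf[symmetric] by (intro sum.cong refl anti)
    also have "(\<Sum>i\<in>UNIV. \<Sum>k\<in>UNIV. a i k * (?X i * ?X k)) = I"
      unfolding I_def by (rule sum.swap)
    finally have "I = 0" by simp
    have "(S has_real_derivative (\<Sum>i\<in>UNIV. 2 * growth a i (x t) * ?X i)) (at t within {..0})"
      unfolding S_def norm_sq_components using that
      by (auto intro!: derivative_eq_intros solves_component[OF sol] sum.cong simp: power2_eq_square)
    also have "(\<Sum>i\<in>UNIV. 2 * growth a i (x t) * ?X i)
        = (\<Sum>i\<in>UNIV. 2 * (1 - S t) * ?X i + 2 * (\<Sum>k\<in>UNIV. a k i * (?X k * ?X i)))"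
      unfolding growth_def S_def
      by (simp add: distrib_left distrib_right sum_distrib_right mult.assoc)
    also have "\<dots> = (\<Sum>i\<in>UNIV. 2 * (1 - S t) * ?X i) + 2 * I"
      by (simp add: I_def sum.distrib sum_distrib_left)
    also have "\<dots> = 2 * S t * (1 - S t)"
      using \<open>I = 0\<close> norm_sq_components[of "x t"] by (simp add: sum_distrib_left[symmetric] S_def)
    finally show ?thesis .
  qed
  have "(S t - 1)\<^sup>2 = 0"
  proof (rule zero_if_decaying_backwards[where z = "\<lambda>t. (S t - 1)\<^sup>2" and S = "{..0}"
        and z' = "\<lambda>t. - 4 * S t * (S t - 1)\<^sup>2"])
    have "((\<lambda>t. (norm (x t))\<^sup>2) \<longlongrightarrow> (norm (equil j :: real^'v))\<^sup>2) at_bot"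
      using lim by (intro tendsto_intros)
    then show "((\<lambda>t. (S t - 1)\<^sup>2) \<longlongrightarrow> 0) at_bot"
      unfolding S_def[symmetric] by (auto intro!: tendsto_eq_intros simp: equil_def)
    fix \<tau> assume "\<tau> \<le> t"
    then show "((\<lambda>t. (S t - 1)\<^sup>2) has_real_derivative - 4 * S \<tau> * (S \<tau> - 1)\<^sup>2) (at \<tau> within {..0})"
      using \<open>t \<le> 0\<close>
      by (auto intro!: derivative_eq_intros radial simp: power2_eq_square algebra_simps)
    show "- 4 * S \<tau> * (S \<tau> - 1)\<^sup>2 \<le> 0" by (simp add: S_def)
  qed (use assms(2) in auto)
  then have "(norm (x t))\<^sup>2 = 1" by (simp add: S_def)
  then show ?thesis using power2_eq_imp_eq[of "norm (x t)" 1] by simp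
qed

end

section \<open>Explicit orbits on transitive tournaments\<close>

text \<open>
  If \<open>X' = 2 X (1 - X)\<close> and \<open>X 0 = c\<^sup>2\<close> with \<open>c \<ge> 0\<close>, then the square root of \<open>X\<close> is
  \<open>c * exp t * damping c t\<close>.  The factor \<open>damping c\<close> is singled out because its logarithmic
  derivative is \<open>- X\<close>: the product of one such factor and another one in reversed time solves the
  equation of the middle vertex of a transitive tournament.
\<close>

definition damping :: "real \<Rightarrow> real \<Rightarrow> real" where
  "damping c t = 1 / sqrt (1 - c\<^sup>2 + c\<^sup>2 * exp (2 * t))"

lemma damping_radicand_pos:
  fixes c :: real assumes "c\<^sup>2 \<le> 1" shows "1 - c\<^sup>2 + c\<^sup>2 * exp (2 * t) > 0"
proof (cases "c = 0")
  case False then show ?thesis using assms by (intro add_nonneg_pos) auto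
qed simp

lemma damping_sq: "c\<^sup>2 \<le> 1 \<Longrightarrow> (damping c t)\<^sup>2 * (1 - c\<^sup>2 + c\<^sup>2 * exp (2 * t)) = 1"
  using damping_radicand_pos[of c t] by (simp add: damping_def power_divide)

lemma damping_pos: "c\<^sup>2 \<le> 1 \<Longrightarrow> damping c t > 0"
  using damping_radicand_pos[of c t] by (simp add: damping_def)

lemma damping_0: "damping c 0 = 1"
  by (simp add: damping_def)

lemma damping_deriv:
  assumes "c\<^sup>2 \<le> 1"
  shows "(damping c has_real_derivative - (c * exp t * damping c t)\<^sup>2 * damping c t) (at t)"
proof -
  let ?D = "\<lambda>t. 1 - c\<^sup>2 + c\<^sup>2 * exp (2 * t)"
  have pos: "?D t > 0" using assms by (rule damping_radicand_pos)
  have e: "exp (2 * t) = (exp t)\<^sup>2" by (simp add: exp_double)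
  have "(damping c has_real_derivative
      - (c\<^sup>2 * (exp (2 * t) * 2) * (inverse (sqrt (?D t)) / 2)) / (sqrt (?D t) * sqrt (?D t))) (at t)"
    unfolding damping_def[abs_def]
    using pos by (auto intro!: derivative_eq_intros)
  also have "- (c\<^sup>2 * (exp (2 * t) * 2) * (inverse (sqrt (?D t)) / 2)) / (sqrt (?D t) * sqrt (?D t))
      = - (c * exp t * damping c t)\<^sup>2 * damping c t"
    using pos by (simp add: damping_def power_mult_distrib power_divide e[symmetric] field_simps)
  finally show ?thesis .
qed

lemma logistic_limit:
  fixes c :: real
  assumes "c > 0"
  shows "((\<lambda>t. c * exp t * damping c t) \<longlongrightarrow> 1) at_top"
proof -
  have "c * exp t * damping c t = c / sqrt ((1 - c\<^sup>2) * exp (- (2 * t)) + c\<^sup>2)" for t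
  proof -
    have "exp (2 * t) * exp (- (2 * t)) = 1" by (simp add: exp_minus)
    then have "1 - c\<^sup>2 + c\<^sup>2 * exp (2 * t) = exp (2 * t) * ((1 - c\<^sup>2) * exp (- (2 * t)) + c\<^sup>2)"
      by algebra
    then have "1 - c\<^sup>2 + c\<^sup>2 * exp (2 * t) = (exp t)\<^sup>2 * ((1 - c\<^sup>2) * exp (- (2 * t)) + c\<^sup>2)"
      by (simp only: exp_double)
    then show ?thesis by (simp add: damping_def real_sqrt_mult)
  qed
  moreover have "((\<lambda>t. exp (- (2 * t)) :: real) \<longlongrightarrow> 0) at_top"
    by real_asymp
  then have "((\<lambda>t. c / sqrt ((1 - c\<^sup>2) * exp (- (2 * t)) + c\<^sup>2))
      \<longlongrightarrow> c / sqrt ((1 - c\<^sup>2) * 0 + c\<^sup>2)) at_top"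
    using assms by (intro tendsto_intros) auto
  ultimately show ?thesis using assms by simp
qed

text \<open>
  The orbit with initial value \<open>(\<alpha>, \<kappa>, \<beta>)\<close> of the three-dimensional subsystem on a transitive
  tournament \<open>p \<rightarrow> q\<close>, \<open>q \<rightarrow> r\<close>, \<open>p \<rightarrow> r\<close> with coefficients \<open>1\<close> and \<open>- 1\<close>.  On the unit sphere the
  squares \<open>X\<^sub>p\<close>, \<open>X\<^sub>q\<close>, \<open>X\<^sub>r\<close> sum to \<open>1\<close>; so \<open>X\<^sub>r\<close>, which profits from both others, satisfies
  \<open>X\<^sub>r' = 2 X\<^sub>r (1 - X\<^sub>r)\<close>, and \<open>X\<^sub>p\<close> satisfies the same equation in reversed time.  In the middle,
  \<open>X\<^sub>q' = 2 X\<^sub>q (X\<^sub>p - X\<^sub>r)\<close>.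
\<close>

definition transitive_orbit ::
    "'v \<Rightarrow> 'v \<Rightarrow> 'v \<Rightarrow> real \<Rightarrow> real \<Rightarrow> real \<Rightarrow> real \<Rightarrow> real^'v::finite" where
  "transitive_orbit p q r \<alpha> \<kappa> \<beta> t =
     (\<alpha> * exp (- t) * damping \<alpha> (- t)) *\<^sub>R equil p +
     (\<kappa> * damping \<alpha> (- t) * damping \<beta> t) *\<^sub>R equil q +
     (\<beta> * exp t * damping \<beta> t) *\<^sub>R equil r"

text \<open>
  The case \<open>Q = 0\<close> asks nothing of the middle vertex, so that the same formulas cover the
  dynamics in the coordinate plane of a single edge.
\<close>

lemma simplex_field_transitive:
  fixes a :: "'v::finite \<Rightarrow> 'v \<Rightarrow> real" and P Q R :: real
  assumes coeff: "a p p = 0" "a r r = 0" "a p r = 1" "a r p = - 1"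
    and mid: "Q = 0 \<or> a q q = 0 \<and> a p q = 1 \<and> a q p = - 1 \<and> a q r = 1 \<and> a r q = - 1"
    and unit: "P\<^sup>2 + Q\<^sup>2 + R\<^sup>2 = 1"
  defines "x \<equiv> P *\<^sub>R equil p + Q *\<^sub>R equil q + R *\<^sub>R equil r :: real^'v"
  shows "norm x = 1"
    and "simplex_field a x = ((P\<^sup>2 - 1) * P) *\<^sub>R equil p + ((P\<^sup>2 - R\<^sup>2) * Q) *\<^sub>R equil q
      + ((1 - R\<^sup>2) * R) *\<^sub>R equil r"
proof -
  have distinct: "p \<noteq> r" "Q = 0 \<or> p \<noteq> q \<and> q \<noteq> r" using coeff mid by auto
  have sq: "(x $ l)\<^sup>2 = (if l = p then P\<^sup>2 else 0) + (if l = q then Q\<^sup>2 else 0)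
      + (if l = r then R\<^sup>2 else 0)" for l
    using distinct by (auto simp: x_def equil_def axis_def)
  have sum3: "(\<Sum>l\<in>UNIV. b l * (x $ l)\<^sup>2) = b p * P\<^sup>2 + b q * Q\<^sup>2 + b r * R\<^sup>2" for b :: "'v \<Rightarrow> real"
    unfolding sq by (simp add: distrib_left sum.distrib if_distrib[of "\<lambda>y. _ * y"] cong: if_cong)
  have "(norm x)\<^sup>2 = 1" unfolding norm_sq_components using sum3[of "\<lambda>_. 1"] unit by simp
  then show "norm x = 1" using power2_eq_imp_eq[of "norm x" 1] by simp
  then have g: "growth a i x = a p i * P\<^sup>2 + a q i * Q\<^sup>2 + a r i * R\<^sup>2" for i
    unfolding growth_def sum3 by simp
  have "growth a p x = P\<^sup>2 - 1" "growth a r x = 1 - R\<^sup>2" "Q = 0 \<or> growth a q x = P\<^sup>2 - R\<^sup>2"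
    unfolding g using coeff mid unit by (auto simp: algebra_simps)
  then show "simplex_field a x = ((P\<^sup>2 - 1) * P) *\<^sub>R equil p + ((P\<^sup>2 - R\<^sup>2) * Q) *\<^sub>R equil q
      + ((1 - R\<^sup>2) * R) *\<^sub>R equil r"
    using distinct by (auto simp: vec_eq_iff simplex_field_component x_def equil_def axis_def)
qed

context
  fixes a :: "'v::finite \<Rightarrow> 'v \<Rightarrow> real" and p q r :: 'v and \<alpha> \<kappa> \<beta> :: real
  assumes unit: "\<alpha>\<^sup>2 + \<kappa>\<^sup>2 + \<beta>\<^sup>2 = 1"
    and coeff: "a p p = 0" "a r r = 0" "a p r = 1" "a r p = - 1"
    and coeff_mid: "\<kappa> = 0 \<or> a q q = 0 \<and> a p q = 1 \<and> a q p = - 1 \<and> a q r = 1 \<and> a r q = - 1"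
begin

private abbreviation "P t \<equiv> \<alpha> * exp (- t) * damping \<alpha> (- t)"
private abbreviation "Q t \<equiv> \<kappa> * damping \<alpha> (- t) * damping \<beta> t"
private abbreviation "R t \<equiv> \<beta> * exp t * damping \<beta> t"

lemma alpha_beta_sq_le_1: "\<alpha>\<^sup>2 \<le> 1" "\<beta>\<^sup>2 \<le> 1"
  using unit by (smt (verit) zero_le_power2)+

lemma orbit_unit: "(P t)\<^sup>2 + (Q t)\<^sup>2 + (R t)\<^sup>2 = 1"
proof -
  define A B E F where "A = (damping \<alpha> (- t))\<^sup>2" and "B = (damping \<beta> t)\<^sup>2"
    and "E = exp (- (2 * t))" and "F = exp (2 * t)"
  have A: "A * (1 - \<alpha>\<^sup>2 + \<alpha>\<^sup>2 * E) = 1" and B: "B * (1 - \<beta>\<^sup>2 + \<beta>\<^sup>2 * F) = 1"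
    using damping_sq[OF alpha_beta_sq_le_1(1), of "- t"] damping_sq[OF alpha_beta_sq_le_1(2), of t]
    by (simp_all add: A_def B_def E_def F_def)
  have EF: "E * F = 1" by (simp add: E_def F_def exp_minus)
  have "(exp t)\<^sup>2 = F" "(exp (- t))\<^sup>2 = E"
    by (simp_all add: E_def F_def exp_double[symmetric])
  then have "(P t)\<^sup>2 + (Q t)\<^sup>2 + (R t)\<^sup>2
      = \<alpha>\<^sup>2 * E * A + (1 - \<alpha>\<^sup>2 - \<beta>\<^sup>2) * A * B + \<beta>\<^sup>2 * F * B"
    using unit by (simp add: power_mult_distrib A_def B_def flip: unit)
  also have "\<dots> = 1" using A B EF by algebra
  finally show ?thesis .
qed

lemma orbit_0: "transitive_orbit p q r \<alpha> \<kappa> \<beta> 0 = \<alpha> *\<^sub>R equil p + \<kappa> *\<^sub>R equil q + \<beta> *\<^sub>R equil r"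
  by (simp add: transitive_orbit_def damping_0)

lemma orbit_solves: "solves_on (transitive_orbit p q r \<alpha> \<kappa> \<beta>) (simplex_field a) UNIV"
  unfolding solves_on_def
proof
  fix t :: real
  let ?x = "transitive_orbit p q r \<alpha> \<kappa> \<beta> t"
  have "((\<lambda>t. damping \<alpha> (- t)) has_real_derivative - (P t)\<^sup>2 * damping \<alpha> (- t) * - 1) (at t)"
    by (rule DERIV_chain2[OF damping_deriv[OF alpha_beta_sq_le_1(1)]]) (auto intro!: derivative_eq_intros)
  then have dP: "((\<lambda>t. damping \<alpha> (- t)) has_real_derivative (P t)\<^sup>2 * damping \<alpha> (- t)) (at t)"
    by simp
  note dR = damping_deriv[OF alpha_beta_sq_le_1(2), of t]
  have P: "(P has_real_derivative ((P t)\<^sup>2 - 1) * P t) (at t)"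
    by (auto intro!: derivative_eq_intros dP simp: algebra_simps)
  have Q: "(Q has_real_derivative ((P t)\<^sup>2 - (R t)\<^sup>2) * Q t) (at t)"
    by (auto intro!: derivative_eq_intros dP dR simp: algebra_simps)
  have R: "(R has_real_derivative (1 - (R t)\<^sup>2) * R t) (at t)"
    by (auto intro!: derivative_eq_intros dR simp: algebra_simps)
  have scale: "((\<lambda>s. f s *\<^sub>R v) has_vector_derivative f' *\<^sub>R v) (at t)"
    if "(f has_real_derivative f') (at t)" for f f' and v :: "real^'v"
    using has_vector_derivative_scaleR[OF that has_vector_derivative_const[of v]] by simp
  have "(transitive_orbit p q r \<alpha> \<kappa> \<beta> has_vector_derivative
      (((P t)\<^sup>2 - 1) * P t) *\<^sub>R equil p + (((P t)\<^sup>2 - (R t)\<^sup>2) * Q t) *\<^sub>R equil q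
      + ((1 - (R t)\<^sup>2) * R t) *\<^sub>R equil r) (at t)"
    unfolding transitive_orbit_def[abs_def]
    by (intro has_vector_derivative_add scale P Q R)
  also have "(((P t)\<^sup>2 - 1) * P t) *\<^sub>R equil p + (((P t)\<^sup>2 - (R t)\<^sup>2) * Q t) *\<^sub>R equil q
      + ((1 - (R t)\<^sup>2) * R t) *\<^sub>R equil r = simplex_field a ?x"
    unfolding transitive_orbit_def
    by (rule simplex_field_transitive(2)[OF coeff _ orbit_unit, symmetric]) (use coeff_mid in auto)
  finally show "(transitive_orbit p q r \<alpha> \<kappa> \<beta> has_vector_derivative simplex_field a ?x)
      (at t within UNIV)" .
qed

text \<open>
  For unit vectors \<open>x\<close> the squared distance to \<open>equil i\<close> is \<open>2 - 2 x\<^sub>i\<close>, so one coordinate decides.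
\<close>

lemma orbit_tendsto_equil:
  assumes "((\<lambda>t. transitive_orbit p q r \<alpha> \<kappa> \<beta> t $ i) \<longlongrightarrow> 1) F"
  shows "(transitive_orbit p q r \<alpha> \<kappa> \<beta> \<longlongrightarrow> equil i) F"
proof -
  let ?x = "transitive_orbit p q r \<alpha> \<kappa> \<beta>"
  have "(norm (?x t - equil i))\<^sup>2 = 2 - 2 * ?x t $ i" for t
  proof -
    have "norm (?x t) = 1" unfolding transitive_orbit_def
      by (rule simplex_field_transitive(1)[OF coeff _ orbit_unit]) (use coeff_mid in auto)
    moreover have "?x t \<bullet> equil i = ?x t $ i" by (simp add: equil_def inner_axis)
    moreover have "norm (equil i :: real^'v) = 1" by (simp add: equil_def)
    ultimately show ?thesis
      by (simp add: power2_norm_eq_inner[symmetric] dot_norm_neg)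
  qed
  moreover have "((\<lambda>t. 2 - 2 * ?x t $ i) \<longlongrightarrow> 0) F"
    using tendsto_diff[OF tendsto_const tendsto_mult[OF tendsto_const assms], of 2 2] by simp
  ultimately have "((\<lambda>t. (norm (?x t - equil i))\<^sup>2) \<longlongrightarrow> 0) F" by simp
  then have "((\<lambda>t. norm (?x t - equil i)) \<longlongrightarrow> 0) F" by simp
  then show ?thesis by (subst Lim_null) (rule tendsto_norm_zero_cancel)
qed

lemma orbit_omega_limit:
  assumes "\<beta> > 0" shows "(transitive_orbit p q r \<alpha> \<kappa> \<beta> \<longlongrightarrow> equil r) at_top"
proof (rule orbit_tendsto_equil)
  have "transitive_orbit p q r \<alpha> \<kappa> \<beta> t $ r = \<beta> * exp t * damping \<beta> t" for t
    using coeff coeff_mid by (auto simp: transitive_orbit_def equil_def axis_def)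
  then show "((\<lambda>t. transitive_orbit p q r \<alpha> \<kappa> \<beta> t $ r) \<longlongrightarrow> 1) at_top"
    using logistic_limit[OF assms] by simp
qed

lemma orbit_alpha_limit:
  assumes "\<alpha> > 0" shows "(transitive_orbit p q r \<alpha> \<kappa> \<beta> \<longlongrightarrow> equil p) at_bot"
proof (rule orbit_tendsto_equil)
  have "transitive_orbit p q r \<alpha> \<kappa> \<beta> t $ p = \<alpha> * exp (- t) * damping \<alpha> (- t)" for t
    using coeff coeff_mid by (auto simp: transitive_orbit_def equil_def axis_def)
  then show "((\<lambda>t. transitive_orbit p q r \<alpha> \<kappa> \<beta> t $ p) \<longlongrightarrow> 1) at_bot"
    using logistic_limit[OF assms] by (simp add: filterlim_at_bot_mirror)
qed

lemma transitive_in_stable_manifold: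
  assumes "\<beta> > 0"
  shows "\<alpha> *\<^sub>R equil p + \<kappa> *\<^sub>R equil q + \<beta> *\<^sub>R equil r \<in> stable_manifold (simplex_field a) (equil r)"
  unfolding stable_manifold_def
proof (intro CollectI exI conjI)
  show "solves_on (transitive_orbit p q r \<alpha> \<kappa> \<beta>) (simplex_field a) {0..}"
    using orbit_solves unfolding solves_on_def
    by (blast intro: has_vector_derivative_within_subset)
qed (rule orbit_0 orbit_omega_limit[OF assms])+

end

section \<open>Realisation by coefficients 1 and -1\<close>

text \<open>
  Opposite values on the two orientations of an edge make the coefficients antisymmetric on
  tournaments, which is what keeps unstable manifolds on the unit sphere and the orbits explicit.
\<close>

definition sign_coefficients :: "'v pair_pre_digraph \<Rightarrow> 'v \<Rightarrow> 'v \<Rightarrow> real" where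
  "sign_coefficients H j i = (if j = i then 0 else if (j, i) \<in> parcs H then 1 else - 1)"

lemma simplex_coefficients_sign: "simplex_coefficients H (sign_coefficients H)"
  by (simp add: simplex_coefficients_def sign_coefficients_def)

text \<open>
  The orbit through the midpoint of the quarter circle in the coordinate plane of the edge.
\<close>

lemma realises_sign:
  fixes H :: "('v::finite) pair_pre_digraph"
  assumes "asym (parcs H)" shows "realises H (sign_coefficients H)"
  unfolding realises_def
proof safe
  fix j i assume ji: "(j, i) \<in> parcs H"
  then have "(i, j) \<notin> parcs H" and "j \<noteq> i" using assms by (auto dest: asymD)
  let ?a = "sign_coefficients H" and ?c = "1 / sqrt 2 :: real"
  let ?x = "transitive_orbit j j i ?c 0 ?c"
  have hyps: "?c\<^sup>2 + 0\<^sup>2 + ?c\<^sup>2 = 1" "?a j j = 0" "?a i i = 0" "?a j i = 1" "?a i j = - 1"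
    using ji \<open>(i, j) \<notin> parcs H\<close> \<open>j \<noteq> i\<close> by (auto simp: sign_coefficients_def power_divide)
  note orbit = hyps disjI1[OF refl]
  have "?x t \<in> orthant \<inter> span {equil j, equil i}" for t
  proof
    have "damping ?c s > 0" for s by (rule damping_pos) (simp add: power_divide)
    then have "0 \<le> damping ?c s" for s by (simp add: less_imp_le)
    then show "?x t \<in> orthant"
      by (simp add: orthant_def transitive_orbit_def equil_def axis_def)
    show "?x t \<in> span {equil j, equil i}"
      unfolding transitive_orbit_def by (intro span_add span_scale span_base) auto
  qed
  then have "plane_connection ?a j i ?x"
    unfolding plane_connection_def
    using orbit_solves[OF orbit] orbit_alpha_limit[OF orbit] orbit_omega_limit[OF orbit] by simp
  then show "\<exists>x. plane_connection ?a j i x" by blast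
qed

text \<open>
  A point of an unstable manifold lies on the unit sphere in the coordinate subspace of the vertex
  \<open>j\<close> and its out-neighbours \<open>q\<close> and \<open>r\<close>.  Its forward orbit is explicit, and converges to the
  last vertex of the tournament \<open>j\<close>, \<open>q\<close>, \<open>r\<close> at which the point has a positive coordinate.
\<close>

lemma complete_network_sign:
  fixes H :: "('v::finite) pair_pre_digraph"
  assumes asym: "asym (parcs H)"
    and out: "\<And>j. \<exists>q r. {i. (j, i) \<in> parcs H} = {q, r} \<and> (q = r \<or> (q, r) \<in> parcs H)"
  shows "complete_network H (sign_coefficients H)"
  unfolding complete_network_def
proof (intro allI subsetI)
  fix j :: 'v and z :: "real^'v"
  let ?a = "sign_coefficients H"
  assume z: "z \<in> unstable_manifold (simplex_field ?a) (equil j) \<inter> orthant"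
  have nonneg: "z $ i \<ge> 0" for i using z by (simp add: orthant_def)
  obtain q r where qr: "{i. (j, i) \<in> parcs H} = {q, r}" "q = r \<or> (q, r) \<in> parcs H"
    using out by blast
  then have jq: "(j, q) \<in> parcs H" and jr: "(j, r) \<in> parcs H" by auto
  have fwd: "?a k l = 1" "?a l k = - 1" if "(k, l) \<in> parcs H" for k l
    using that asym by (auto simp: sign_coefficients_def dest: asymD)
  have self: "?a k k = 0" for k by (simp add: sign_coefficients_def)
  have neq: "j \<noteq> q" "j \<noteq> r" using jq jr asym by (auto dest: asymD)
  have out_j: "i = j \<or> i = q \<or> i = r" if "i \<noteq> j \<longrightarrow> ?a j i \<ge> 0" for i
    using that qr(1) by (auto simp: sign_coefficients_def split: if_splits)
  obtain x where x: "solves_on x (simplex_field ?a) {..0}" "x 0 = z" "(x \<longlongrightarrow> equil j) at_bot"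
    using z unfolding unstable_manifold_def by blast
  have "norm (x 0) = 1"
  proof (rule unstable_trajectory_sphere[OF x(1,3)])
    fix i k assume "i \<noteq> j \<longrightarrow> ?a j i \<ge> 0" "k \<noteq> j \<longrightarrow> ?a j k \<ge> 0"
    then have "i \<in> {j, q, r}" "k \<in> {j, q, r}" using out_j by blast+
    then show "?a i k = - ?a k i" using fwd[OF jq] fwd[OF jr] fwd[of q r] qr(2) self by auto
  qed simp
  have supp: "z $ i = 0" if "i \<notin> {j, q, r}" for i
    using unstable_trajectory_contracting[OF x(1,3), of i 0] out_j[of i] that x(2)
    by (force simp: not_le)
  \<comment> \<open>if there is only one out-neighbour, its coordinate must not be counted twice\<close>
  define \<kappa> where "\<kappa> = (if q = r then 0 else z $ q)"
  have z_eq: "z = z $ j *\<^sub>R equil j + \<kappa> *\<^sub>R equil q + z $ r *\<^sub>R equil r"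
    unfolding vec_eq_iff
  proof
    fix i show "z $ i = (z $ j *\<^sub>R equil j + \<kappa> *\<^sub>R equil q + z $ r *\<^sub>R equil r) $ i"
      using supp[of i] neq by (auto simp: \<kappa>_def equil_def axis_def)
  qed
  have "(norm z)\<^sup>2 = (z $ j)\<^sup>2 + \<kappa>\<^sup>2 + (z $ r)\<^sup>2"
  proof -
    have "(\<Sum>i\<in>UNIV. (z $ i)\<^sup>2) = (\<Sum>i\<in>{j, q, r}. (z $ i)\<^sup>2)"
      using supp by (intro sum.mono_neutral_right) auto
    then show ?thesis using neq unfolding norm_sq_components by (auto simp: \<kappa>_def)
  qed
  then have unit: "(z $ j)\<^sup>2 + \<kappa>\<^sup>2 + (z $ r)\<^sup>2 = 1"
    using \<open>norm (x 0) = 1\<close> x(2) by simp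
  consider "z $ r > 0" | "z $ r = 0" "\<kappa> > 0" | "z $ r = 0" "\<kappa> = 0"
    using nonneg[of r] nonneg[of q] unfolding \<kappa>_def by (metis order_le_less)
  then show "z \<in> simplex_network H ?a"
  proof cases
    case 1
    have "z $ j *\<^sub>R equil j + \<kappa> *\<^sub>R equil q + z $ r *\<^sub>R equil r
        \<in> stable_manifold (simplex_field ?a) (equil r)"
      using fwd[OF jq] fwd[OF jr] fwd[of q r] qr(2) self unit 1
      by (intro transitive_in_stable_manifold) (auto simp: \<kappa>_def)
    then have "z \<in> connection ?a j r" using z z_eq by (simp add: connection_def)
    then show ?thesis using jr unfolding simplex_network_def by blast
  next
    case 2
    have "z $ j *\<^sub>R equil j + 0 *\<^sub>R equil j + \<kappa> *\<^sub>R equil q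
        \<in> stable_manifold (simplex_field ?a) (equil q)"
      using fwd[OF jq] self unit 2
      by (intro transitive_in_stable_manifold) auto
    then have "z \<in> connection ?a j q" using z z_eq 2 by (simp add: connection_def)
    then show ?thesis using jq unfolding simplex_network_def by blast
  next
    case 3
    then have "z $ j = 1" using unit nonneg[of j] by (simp add: power2_eq_1_iff)
    then have "z = equil j" using z_eq 3 by simp
    then show ?thesis unfolding simplex_network_def by blast
  qed
qed

lemma (in two_cycles_at_vertex) complete_realisation_completed:
  "complete_realisation G completed (sign_coefficients completed)"
  unfolding complete_realisation_def
  using verts strongly_connected no_1_2_cycles_G spanning_completed
    asym_imp_no_1_2_cycles[OF asym_completed] simplex_coefficients_sign
    realises_sign[OF asym_completed]
    complete_network_sign[OF asym_completed out_neighbours_completed]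
  by (intro conjI)

lemma (in two_cycles_at_vertex) positive_transverse_eigenvalues_completed:
  "positive_transverse_eigenvalues (sign_coefficients completed) C = {(distribution_vertex G, w)}"
proof -
  have "(\<exists>\<mu>>0. eigenvalue_in_direction (simplex_field (sign_coefficients completed)) (equil j) i \<mu>)
      \<longleftrightarrow> (j, i) \<in> parcs completed" if "transverse C j i" for j i
    using that unfolding transverse_def
    by (auto simp: eigenvalue_in_direction_equil sign_coefficients_def)
  then have "positive_transverse_eigenvalues (sign_coefficients completed) C
      = {(j, i). transverse C j i \<and> (j, i) \<in> parcs completed}"
    unfolding positive_transverse_eigenvalues_def by blast
  then show ?thesis by (simp add: transverse_arcs_completed distribution_vertex)
qed

theorem proposition4p1:
  fixes G :: "('v::finite) pair_pre_digraph" and C1 C2 :: "('v \<times> 'v) list"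
  assumes "pverts G = UNIV"
    and "consists_of_two_cycles G C1 C2"
    and "length C1 \<ge> 3" and "length C2 \<ge> 3"
    and "card (cycle_verts C1 \<inter> cycle_verts C2) = 1"
  shows "\<forall>C\<in>{C1, C2}. \<exists>G' a. complete_realisation G G' a \<and>
           (\<exists>i. positive_transverse_eigenvalues a C = {(distribution_vertex G, i)})"
proof -
  obtain d where d: "cycle_verts C1 \<inter> cycle_verts C2 = {d}"
    using assms(5) by (auto simp: card_1_singleton_iff)
  then obtain u1 u2 where u: "(d, u1) \<in> set C1" "(d, u2) \<in> set C2"
    by (force simp: cycle_verts_def)
  have two: "pre_digraph.cycle (with_proj G) C1" "pre_digraph.cycle (with_proj G) C2"
      "cycle_verts C1 \<union> cycle_verts C2 = UNIV" "parcs G = set C1 \<union> set C2"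
    using assms(1,2) by (auto simp: consists_of_two_cycles_def)
  have "two_cycles_at_vertex G C1 C2 d u1 u2"
    by unfold_locales (use assms(1,3,4) d u two in simp_all)
  moreover have "two_cycles_at_vertex G C2 C1 d u2 u1"
    by unfold_locales (use assms(1,3,4) d u two in \<open>simp_all add: Un_commute Int_commute\<close>)
  moreover have "\<exists>G' a. complete_realisation G G' a \<and>
      (\<exists>i. positive_transverse_eigenvalues a C = {(distribution_vertex G, i)})"
    if "two_cycles_at_vertex G C D d u w" for C D u w
    using two_cycles_at_vertex.complete_realisation_completed[OF that]
      two_cycles_at_vertex.positive_transverse_eigenvalues_completed[OF that]
    by (intro exI conjI)
  ultimately show ?thesis by (metis insertE singletonD)
qed

end
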